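(* Consider an election with ordered ballots and $s$ seats. Let $i_1,\dots,i_s$ be the candidates elected by Phragmén's ordered method, in the order they are elected, and let $Q:=W^{(s)}$ be the reduced vote of the last elected candidate $i_s$ at the time it is elected; assume $Q>0$. Then Phragmén's method yields the same result as STV with the inclusive Gregory method and quota $Q$, provided that the surpluses are transferred in the order $i_1,\dots,i_s$ in which the candidates are elected by Phragmén's method (ties being resolved in accordance with this order); that is, this STV procedure elects exactly the candidates $i_1,\dots,i_s$.
   Context: There is a finite set of candidates and a finite multiset of ballots; each ballot is an ordered list of distinct candidates (not necessarily all of them). $s\ge1$ candidates are to be elected. Phragmén's ordered method: every ballot $b$ has a place number $r_b$, initially $0$. Seats are filled one by one until $s$ candidates have been elected. For each seat, each ballot is counted only for its current top candidate, i.e. the first candidate on it that is not yet elected (ballots all of whose candidates are elected are ignored). For a not yet elected candidate $i$, let $B_i$ be the set of ballots currently counted for $i$; the reduced vote of $i$ is $W_i:=|B_i|/(1+\sum_{b\in B_i} r_b)$. A candidate $i$ with the largest $W_i$ is elected (ties broken arbitrarily), and then $r_b$ is replaced by $1/W_i$ for all $b\in B_i$ (other place numbers are unchanged). $W^{(k)}$ denotes the reduced vote $W_i$ of the candidate elected to the $k$-th seat, at the time it is elected. STV with the inclusive Gregory method and quota $Q$: each ballot has initially the value $1$. Each ballot is counted, with its current value, only for the first candidate on it that has not been elected (or eliminated). If some candidate's total value $v$ of the ballots counted for it is at least $Q$, the candidate has reached the quota and is elected, and its surplus $v-Q$ is transferred: if $N$ ballots are counted for the candidate, all $N$ of them get the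 new value $(v-Q)/N$ each and are from then on counted for the next remaining candidate on them (if any). If several candidates have reached the quota, their surpluses are transferred one at a time, in some prescribed order. This is repeated until $s$ candidates have been elected; if fewer than $s$ candidates have been elected and no remaining candidate reaches the quota, the remaining candidate with the smallest total value is eliminated and its ballots are transferred, with unchanged value, to the next remaining candidate on them. In the procedure in the theorem, at the $k$-th stage ($k=1,\dots,s$) the candidate whose election and surplus transfer is carried out is, among the candidates that have reached the quota, the one prescribed by the order, i.e. $i_k$; 'the same result' includes that $i_k$ indeed has reached the quota $Q$ at that stage. *)

theory Defs
  imports Complex_Main
begin

text \<open>
  The multiset of ballots is a finite family: \<open>V\<close> is the finite set of ballot papers and
  \<open>pref b\<close> is the ranking written on paper \<open>b\<close>, so that equal rankings may occur repeatedly
  and each single ballot carries its own place number or value.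
\<close>

definition ordered_election :: "'c set \<Rightarrow> 'b set \<Rightarrow> ('b \<Rightarrow> 'c list) \<Rightarrow> bool" where
  "ordered_election C V pref \<longleftrightarrow>
     finite C \<and> finite V \<and> (\<forall>b\<in>V. distinct (pref b) \<and> set (pref b) \<subseteq> C)"

text \<open>
  The ballots counted for \<open>c\<close> when the candidates in \<open>D\<close> (elected or eliminated) are out of
  play: those whose first candidate outside \<open>D\<close> is \<open>c\<close>.
\<close>

definition counted_for :: "'b set \<Rightarrow> ('b \<Rightarrow> 'c list) \<Rightarrow> 'c set \<Rightarrow> 'c \<Rightarrow> 'b set" where
  "counted_for V pref D c = {b \<in> V. find (\<lambda>d. d \<notin> D) (pref b) = Some c}"


subsection \<open>Phragm\'en's ordered method\<close>

definition reduced_vote ::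
  "'b set \<Rightarrow> ('b \<Rightarrow> 'c list) \<Rightarrow> 'c set \<Rightarrow> ('b \<Rightarrow> real) \<Rightarrow> 'c \<Rightarrow> real" where
  "reduced_vote V pref D r c =
     real (card (counted_for V pref D c)) / (1 + (\<Sum>b\<in>counted_for V pref D c. r b))"

text \<open>
  \<open>phragmen_run C V pref es r Ws\<close>: filling the seats one by one, with some resolution of the
  ties, may elect the candidates \<open>es\<close> in this order, with reduced votes \<open>Ws\<close> at the times of
  their election, and leave the place numbers \<open>r\<close>.
\<close>

inductive phragmen_run ::
  "'c set \<Rightarrow> 'b set \<Rightarrow> ('b \<Rightarrow> 'c list) \<Rightarrow> 'c list \<Rightarrow> ('b \<Rightarrow> real) \<Rightarrow> real list \<Rightarrow> bool"
  for C :: "'c set" and V :: "'b set" and pref :: "'b \<Rightarrow> 'c list"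
where
  start: "phragmen_run C V pref [] (\<lambda>_. 0) []"
| seat: "\<lbrakk> phragmen_run C V pref es r Ws;
           c \<in> C - set es;
           \<forall>d \<in> C - set es. reduced_vote V pref (set es) r d \<le> reduced_vote V pref (set es) r c;
           W = reduced_vote V pref (set es) r c \<rbrakk>
         \<Longrightarrow> phragmen_run C V pref (es @ [c])
               (\<lambda>b. if b \<in> counted_for V pref (set es) c then 1 / W else r b) (Ws @ [W])"


subsection \<open>STV with the inclusive Gregory method\<close>

record ('b, 'c) stv_state =
  elected :: "'c list"
  eliminated :: "'c set"
  ballot_value :: "'b \<Rightarrow> real"

definition stv_init :: "('b, 'c) stv_state" where
  "stv_init = \<lparr>elected = [], eliminated = {}, ballot_value = (\<lambda>_. 1)\<rparr>"

definition remaining :: "'c set \<Rightarrow> ('b, 'c) stv_state \<Rightarrow> 'c set" where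
  "remaining C S = C - (set (elected S) \<union> eliminated S)"

definition stv_ballots ::
  "'b set \<Rightarrow> ('b \<Rightarrow> 'c list) \<Rightarrow> ('b, 'c) stv_state \<Rightarrow> 'c \<Rightarrow> 'b set" where
  "stv_ballots V pref S c = counted_for V pref (set (elected S) \<union> eliminated S) c"

definition stv_total ::
  "'b set \<Rightarrow> ('b \<Rightarrow> 'c list) \<Rightarrow> ('b, 'c) stv_state \<Rightarrow> 'c \<Rightarrow> real" where
  "stv_total V pref S c = (\<Sum>b\<in>stv_ballots V pref S c. ballot_value S b)"

definition reaches_quota ::
  "real \<Rightarrow> 'c set \<Rightarrow> 'b set \<Rightarrow> ('b \<Rightarrow> 'c list) \<Rightarrow> ('b, 'c) stv_state \<Rightarrow> 'c \<Rightarrow> bool" where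
  "reaches_quota Q C V pref S c \<longleftrightarrow> c \<in> remaining C S \<and> Q \<le> stv_total V pref S c"

text \<open>
  One stage: an election together with its surplus transfer, or an elimination. The list
  \<open>ord\<close> enumerates all candidates and is the prescribed order in which surpluses are
  transferred when several candidates have reached the quota; a candidate still waiting for
  this counts as remaining. There is no step once \<open>s\<close> candidates have been elected. Ties
  for the elimination are resolved arbitrarily.
\<close>

inductive stv_step ::
  "nat \<Rightarrow> real \<Rightarrow> 'c list \<Rightarrow> 'c set \<Rightarrow> 'b set \<Rightarrow> ('b \<Rightarrow> 'c list) \<Rightarrow>
   ('b, 'c) stv_state \<Rightarrow> ('b, 'c) stv_state \<Rightarrow> bool"
  for s :: nat and Q :: real and ord :: "'c list"
    and C :: "'c set" and V :: "'b set" and pref :: "'b \<Rightarrow> 'c list"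
where
  elect: "\<lbrakk> length (elected S) < s;
            find (reaches_quota Q C V pref S) ord = Some c \<rbrakk>
          \<Longrightarrow> stv_step s Q ord C V pref S
                \<lparr>elected = elected S @ [c],
                 eliminated = eliminated S,
                 ballot_value = (\<lambda>b. if b \<in> stv_ballots V pref S c
                   then (stv_total V pref S c - Q) / real (card (stv_ballots V pref S c))
                   else ballot_value S b)\<rparr>"
| eliminate: "\<lbrakk> length (elected S) < s;
                \<forall>d. \<not> reaches_quota Q C V pref S d;
                c \<in> remaining C S;
                \<forall>d \<in> remaining C S. stv_total V pref S c \<le> stv_total V pref S d \<rbrakk>
              \<Longrightarrow> stv_step s Q ord C V pref S (S\<lparr>eliminated := insert c (eliminated S)\<rparr>)"

text \<open>
  The possible lists of candidates elected when the procedure has come to its end; here no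
  number of elected candidates is presupposed.
\<close>

definition stv_result ::
  "nat \<Rightarrow> real \<Rightarrow> 'c list \<Rightarrow> 'c set \<Rightarrow> 'b set \<Rightarrow> ('b \<Rightarrow> 'c list) \<Rightarrow> 'c list \<Rightarrow> bool" where
  "stv_result s Q ord C V pref es \<longleftrightarrow>
     (\<exists>S. (stv_step s Q ord C V pref)\<^sup>*\<^sup>* stv_init S \<and>
          (\<nexists>T. stv_step s Q ord C V pref S T) \<and> elected S = es)"

end

theory Submission
  imports Defs
begin

text \<open>
  If a ballot \<open>b\<close> has place number \<open>r b\<close> in Phragm\'en's method, its value in STV at the same
  stage is \<open>1 - Q * r b\<close>. With this correspondence a candidate with \<open>n > 0\<close> ballots and reduced
  vote \<open>W\<close> has the total \<open>n * (1 - Q / W) + Q\<close>, which is at least \<open>Q\<close> exactly if \<open>W \<ge> Q\<close>,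
  and the surplus transfer gives each of its ballots the value \<open>1 - Q / W\<close>, matching the new
  place number \<open>1 / W\<close>. Reduced votes of successively elected candidates never increase, so the
  last one is a quota that every elected candidate reaches at its turn.
\<close>

section \<open>Monotonicity of the reduced votes in Phragmen's method\<close>

lemma find_notin_insert:
  assumes "c \<noteq> i"
  shows "find (\<lambda>d. d \<notin> insert i D) xs = Some c \<longleftrightarrow>
    find (\<lambda>d. d \<notin> D) xs = Some c \<or>
    find (\<lambda>d. d \<notin> D) xs = Some i \<and> find (\<lambda>d. d \<notin> insert i D) xs = Some c"
  using assms by (induction xs) auto

text \<open>Only ballots whose top candidate was \<open>i\<close> can change hands. \<open>M\<close>
  collects those that pass from \<open>i\<close> to \<open>c\<close>; the other ballots of
  \<open>i\<close> go to further candidates or are exhausted.\<close>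

lemma counted_for_insert:
  assumes "c \<noteq> i"
  obtains M where "M \<subseteq> counted_for V pref D i"
    and "counted_for V pref (insert i D) c = counted_for V pref D c \<union> M"
proof
  let ?M = "counted_for V pref D i \<inter> counted_for V pref (insert i D) c"
  show "?M \<subseteq> counted_for V pref D i" by blast
  show "counted_for V pref (insert i D) c = counted_for V pref D c \<union> ?M"
    unfolding counted_for_def using find_notin_insert[OF assms, of D] by blast
qed

lemma counted_for_disjoint:
  "c \<noteq> i \<Longrightarrow> counted_for V pref D c \<inter> counted_for V pref D i = {}"
  by (auto simp: counted_for_def)

lemma finite_counted_for: "finite V \<Longrightarrow> finite (counted_for V pref D c)"
  by (simp add: counted_for_def)

lemma reduced_vote_nonneg:
  assumes "\<forall>b. 0 \<le> r b"
  shows "0 \<le> reduced_vote V pref D r c"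
  unfolding reduced_vote_def using assms by (intro divide_nonneg_nonneg add_nonneg_nonneg sum_nonneg) auto

text \<open>
  The new ballots of \<open>c\<close> come from \<open>i\<close> with place number \<open>1 / W\<close>, so that adding them amounts to
  taking a mediant of the old fraction with \<open>W\<close>. The junk value \<open>1 / 0 = 0\<close> is harmless: if
  \<open>W = 0\<close>, then \<open>i\<close> has no ballots to pass on.
\<close>

lemma reduced_vote_update_le:
  assumes fin: "finite V" and r: "\<forall>b. 0 \<le> r b" and ci: "c \<noteq> i"
    and W: "W = reduced_vote V pref D r i"
    and le: "reduced_vote V pref D r c \<le> W"
  shows "reduced_vote V pref (insert i D)
           (\<lambda>b. if b \<in> counted_for V pref D i then 1 / W else r b) c \<le> W"
proof -
  let ?r = "\<lambda>b. if b \<in> counted_for V pref D i then 1 / W else r b"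
  let ?A = "counted_for V pref D c" and ?B = "counted_for V pref D i"
  obtain M where M: "M \<subseteq> ?B" and eq: "counted_for V pref (insert i D) c = ?A \<union> M"
    using counted_for_insert[OF ci] by blast
  have fA: "finite ?A" and fB: "finite ?B" using fin by (simp_all add: finite_counted_for)
  have fM: "finite M" using M fB finite_subset by blast
  have dAB: "?A \<inter> ?B = {}" using counted_for_disjoint[OF ci] .
  have d: "?A \<inter> M = {}" using dAB M by blast
  have card: "card (?A \<union> M) = card ?A + card M" by (rule card_Un_disjoint[OF fA fM d])
  have "sum ?r ?A = sum r ?A" using dAB by (intro sum.cong) auto
  moreover have "sum ?r M = card M * (1 / W)"
  proof -
    have "sum ?r M = (\<Sum>b\<in>M. 1 / W)" using M by (intro sum.cong) auto
    then show ?thesis by simp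
  qed
  ultimately have sum: "sum ?r (?A \<union> M) = sum r ?A + card M * (1 / W)"
    using sum.union_disjoint[OF fA fM d, of ?r] by simp
  have pos: "0 < 1 + sum r X" for X using r sum_nonneg[of X r] by simp
  have W0: "0 \<le> W" unfolding W using reduced_vote_nonneg[OF r] .
  have m: "card M = W * (card M * (1 / W))"
  proof (cases "W = 0")
    case True
    then have "card ?B = 0" using W pos[of ?B] by (simp add: reduced_vote_def)
    then have "M = {}" using fB M by auto
    then show ?thesis by simp
  qed simp
  have "card ?A \<le> W * (1 + sum r ?A)"
    using le pos[of ?A] by (simp add: reduced_vote_def pos_divide_le_eq)
  then have "real (card ?A + card M) \<le> W * (1 + (sum r ?A + card M * (1 / W)))"
    using m by (simp add: distrib_left)
  moreover have "0 < 1 + (sum r ?A + card M * (1 / W))"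
  proof -
    have "0 \<le> card M * (1 / W)" using W0 by simp
    then show ?thesis using pos[of ?A] by linarith
  qed
  ultimately show ?thesis
    unfolding reduced_vote_def eq card sum by (simp only: pos_divide_le_eq)
qed

lemma phragmen_run_nonneg:
  assumes "phragmen_run C V pref es r Ws"
  shows "\<forall>b. 0 \<le> r b"
  using assms by induction (auto simp: reduced_vote_nonneg)

text \<open>The second conjunct carries the induction: every candidate still in the race stays below
  all earlier winning votes, so the next winning vote can be appended. It survives an election by
  \<open>reduced_vote_update_le\<close> for the newest vote and by transitivity for the older
  ones.\<close>

lemma phragmen_run_reduced_votes_decreasing:
  assumes "phragmen_run C V pref es r Ws" and "finite V"
  shows "sorted_wrt (\<ge>) Ws \<and>
    (\<forall>W\<in>set Ws. \<forall>d\<in>C - set es. reduced_vote V pref (set es) r d \<le> W)"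
  using assms
proof induction
  case start
  then show ?case by simp
next
  case (seat es r Ws c W)
  let ?r = "\<lambda>b. if b \<in> counted_for V pref (set es) c then 1 / W else r b"
  have le: "reduced_vote V pref (insert c (set es)) ?r d \<le> W" if "d \<in> C - insert c (set es)" for d
  proof (rule reduced_vote_update_le)
    show "\<forall>b. 0 \<le> r b" by (rule phragmen_run_nonneg[OF seat.hyps(1)])
    show "W = reduced_vote V pref (set es) r c" by (rule seat.hyps(4))
    show "reduced_vote V pref (set es) r d \<le> W" using that seat.hyps(3,4) by simp
  qed (use that \<open>finite V\<close> in auto)
  have IH: "sorted_wrt (\<ge>) Ws"
    "\<And>W' d. W' \<in> set Ws \<Longrightarrow> d \<in> C - set es \<Longrightarrow> reduced_vote V pref (set es) r d \<le> W'"
    using seat.IH[OF \<open>finite V\<close>] by blast+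
  have W: "W \<le> W'" if "W' \<in> set Ws" for W'
    unfolding seat.hyps(4) using IH(2)[OF that seat.hyps(2)] .
  then have "sorted_wrt (\<ge>) (Ws @ [W])" using IH(1) by (simp add: sorted_wrt_append)
  moreover have "reduced_vote V pref (insert c (set es)) ?r d \<le> W'"
    if "W' \<in> set (Ws @ [W])" "d \<in> C - insert c (set es)" for W' d
    using le[OF that(2)] W that(1) by fastforce
  ultimately show ?case by simp
qed

section \<open>Stages of Phragmen's method as STV states\<close>

definition phragmen_stv_state :: "real \<Rightarrow> 'c list \<Rightarrow> ('b \<Rightarrow> real) \<Rightarrow> ('b, 'c) stv_state" where
  "phragmen_stv_state Q es r = \<lparr>elected = es, eliminated = {}, ballot_value = (\<lambda>b. 1 - Q * r b)\<rparr>"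

lemma stv_total_phragmen_stv_state:
  assumes "W = reduced_vote V pref (set es) r c" and "W > 0"
  shows "stv_total V pref (phragmen_stv_state Q es r) c =
    card (counted_for V pref (set es) c) * (1 - Q / W) + Q"
proof -
  let ?B = "counted_for V pref (set es) c"
  \<comment> \<open>\<open>W > 0\<close> excludes an empty \<open>?B\<close> and a zero denominator,
    so the defining fraction can be solved for the sum of place numbers.\<close>
  have "card ?B / W = 1 + sum r ?B"
    using assms by (auto simp: reduced_vote_def)
  moreover have "stv_total V pref (phragmen_stv_state Q es r) c = card ?B - Q * sum r ?B"
    by (simp add: stv_total_def stv_ballots_def phragmen_stv_state_def sum_subtractf sum_distrib_left)
  ultimately have "stv_total V pref (phragmen_stv_state Q es r) c = card ?B - Q * (card ?B / W - 1)"
    by simp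
  then show ?thesis by (simp add: algebra_simps)
qed

text \<open>The equivalence makes the stage forced: no other election is possible, and an
  elimination is ruled out because \<open>c\<close> has reached the quota.\<close>

lemma stv_step_phragmen_stv_state:
  assumes c: "c \<in> C - set es" and W: "W = reduced_vote V pref (set es) r c"
    and Q: "0 < Q" "Q \<le> W" and len: "length es < s"
    and ord: "take (Suc (length es)) ord = es @ [c]"
  shows "reaches_quota Q C V pref (phragmen_stv_state Q es r) c"
    and "stv_step s Q ord C V pref (phragmen_stv_state Q es r) T \<longleftrightarrow>
      T = phragmen_stv_state Q (es @ [c])
        (\<lambda>b. if b \<in> counted_for V pref (set es) c then 1 / W else r b)"
proof -
  let ?S = "phragmen_stv_state Q es r"
  let ?B = "counted_for V pref (set es) c"
  have tot: "stv_total V pref ?S c = card ?B * (1 - Q / W) + Q"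
    using stv_total_phragmen_stv_state[OF W] Q by simp
  have rem: "remaining C ?S = C - set es"
    by (simp add: remaining_def phragmen_stv_state_def)
  show rq: "reaches_quota Q C V pref ?S c"
    using Q c unfolding reaches_quota_def rem tot by simp
  \<comment> \<open>The search through \<open>ord\<close> skips \<open>es\<close>, whose members no
    longer remain, and stops at \<open>c\<close>, whoever else has reached the quota.\<close>
  have "ord = (es @ [c]) @ drop (Suc (length es)) ord"
    using ord append_take_drop_id by metis
  moreover have "find P (es @ [c]) = Some c" if "P c" "\<forall>x\<in>set es. \<not> P x" for P
    using that by (induction es) auto
  moreover have "find P (xs @ ys) = Some x" if "find P xs = Some x" for P xs ys and x :: 'a
    using that by (induction xs) (auto split: if_splits)
  moreover have "\<forall>x\<in>set es. \<not> reaches_quota Q C V pref ?S x"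
    by (simp add: reaches_quota_def rem)
  ultimately have find: "find (reaches_quota Q C V pref ?S) ord = Some c"
    using rq by metis
  \<comment> \<open>A positive \<open>W\<close> forces \<open>c\<close> to have ballots, so
    \<open>card ?B\<close> cancels in the new value, leaving \<open>1 - Q / W\<close>.\<close>
  have "W = 0" if "card ?B = 0" using W that unfolding reduced_vote_def by (simp only: of_nat_0 div_0)
  then have B0: "card ?B \<noteq> 0" using Q by auto
  have step: "\<lparr>elected = elected ?S @ [c], eliminated = eliminated ?S,
      ballot_value = (\<lambda>b. if b \<in> stv_ballots V pref ?S c
        then (stv_total V pref ?S c - Q) / real (card (stv_ballots V pref ?S c))
        else ballot_value ?S b)\<rparr> =
    phragmen_stv_state Q (es @ [c]) (\<lambda>b. if b \<in> ?B then 1 / W else r b)"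
    unfolding tot using B0 by (auto simp: phragmen_stv_state_def stv_ballots_def)
  show "stv_step s Q ord C V pref ?S T \<longleftrightarrow>
      T = phragmen_stv_state Q (es @ [c]) (\<lambda>b. if b \<in> ?B then 1 / W else r b)"
  proof
    assume "stv_step s Q ord C V pref ?S T"
    then show "T = phragmen_stv_state Q (es @ [c]) (\<lambda>b. if b \<in> ?B then 1 / W else r b)"
    proof cases
      case (elect c')
      then have "c' = c" using find by simp
      then show ?thesis using elect(1) step by (simp only:)
    next
      case eliminate
      then show ?thesis using rq by blast
    qed
  next
    assume "T = phragmen_stv_state Q (es @ [c]) (\<lambda>b. if b \<in> ?B then 1 / W else r b)"
    moreover have "length (elected ?S) < s" using len by (simp add: phragmen_stv_state_def)
    ultimately show "stv_step s Q ord C V pref ?S T"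
      using stv_step.elect[OF _ find, of s] step by simp
  qed
qed

text \<open>\<open>Q\<close> is any positive lower bound of the reduced votes and \<open>s\<close>
  any bound on the length: for a proper prefix of the run, the last reduced vote and the number of
  seats filled differ from the final ones, so fixing them would block the induction.\<close>

lemma stv_follows_phragmen_run:
  assumes "phragmen_run C V pref es r Ws" and "\<forall>W\<in>set Ws. Q \<le> W" and "0 < Q"
    and "length es \<le> s" and "take (length es) ord = es"
  shows "(\<forall>T. (stv_step s Q ord C V pref ^^ length es) stv_init T \<longleftrightarrow> T = phragmen_stv_state Q es r) \<and>
    (\<forall>k<length es. \<exists>S. (\<forall>T. (stv_step s Q ord C V pref ^^ k) stv_init T \<longleftrightarrow> T = S) \<and>
       elected S = take k es \<and> eliminated S = {} \<and> reaches_quota Q C V pref S (es ! k))"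
  using assms
proof induction
  case start
  then show ?case by (auto simp: stv_init_def phragmen_stv_state_def)
next
  case (seat es r Ws c W)
  let ?step = "stv_step s Q ord C V pref"
  have ord: "take (Suc (length es)) ord = es @ [c]" using seat.prems by simp
  then have "take (length es) (take (Suc (length es)) ord) = es" by simp
  then have "take (length es) ord = es" by (simp add: min_def)
  then have IH: "\<And>T. (?step ^^ length es) stv_init T \<longleftrightarrow> T = phragmen_stv_state Q es r"
    "\<forall>k<length es. \<exists>S. (\<forall>T. (?step ^^ k) stv_init T \<longleftrightarrow> T = S) \<and>
       elected S = take k es \<and> eliminated S = {} \<and> reaches_quota Q C V pref S (es ! k)"
    using seat by simp_all
  have "Q \<le> W" "length es < s" using seat.prems by simp_all
  note step = stv_step_phragmen_stv_state[OF seat.hyps(2,4) \<open>0 < Q\<close> this ord]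
  have last: "(?step ^^ length (es @ [c])) stv_init T \<longleftrightarrow> T = phragmen_stv_state Q (es @ [c])
      (\<lambda>b. if b \<in> counted_for V pref (set es) c then 1 / W else r b)" for T
    using IH(1) step(2) by (auto simp: relcompp_apply)
  have "\<exists>S. (\<forall>T. (?step ^^ k) stv_init T \<longleftrightarrow> T = S) \<and> elected S = take k (es @ [c]) \<and>
      eliminated S = {} \<and> reaches_quota Q C V pref S ((es @ [c]) ! k)"
    if "k < length (es @ [c])" for k
  proof (cases "k = length es")
    case True
    then show ?thesis
      using IH(1) step(1) by (intro exI[of _ "phragmen_stv_state Q es r"]) (auto simp: phragmen_stv_state_def)
  next
    case False
    then have "k < length es" using that by simp
    then show ?thesis using IH(2) by (simp add: nth_append)
  qed
  then show ?case using last by blast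
qed

section \<open>Uniqueness of the final state\<close>

text \<open>A state reached in fewer than \<open>n\<close> steps is the only one at its level, hence
  lies on the path to \<open>S\<close> and has a successor. Any path of at least \<open>n\<close>
  steps passes through \<open>S\<close>, where it must end.\<close>

lemma rtranclp_terminal_iff_relpowp:
  assumes "\<And>T. (R ^^ n) x T \<longleftrightarrow> T = S" and "\<nexists>T. R S T"
    and unique: "\<And>k. k < n \<Longrightarrow> \<exists>S'. \<forall>T. (R ^^ k) x T \<longleftrightarrow> T = S'"
  shows "R\<^sup>*\<^sup>* x T \<and> (\<nexists>U. R T U) \<longleftrightarrow> T = S"
proof
  assume T: "R\<^sup>*\<^sup>* x T \<and> (\<nexists>U. R T U)"
  then obtain m where m: "(R ^^ m) x T" by (meson rtranclp_imp_relpowp)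
  have split: "\<exists>y. (R ^^ i) x y \<and> (R ^^ j) y z" if "(R ^^ (i + j)) x z" for i j z
    using that by (auto simp: relpowp_add relcompp_apply)
  have dead: "j = 0 \<and> z = y" if "(R ^^ j) y z" "\<nexists>U. R y U" for j y z
    using that by (cases j) (auto elim: relpowp_E2)
  show "T = S"
  proof (cases "m < n")
    case True
    have "(R ^^ (m + (n - m))) x S" using assms(1) True by simp
    then obtain y where y: "(R ^^ m) x y" "(R ^^ (n - m)) y S" using split by blast
    then have "y = T" using unique[OF True] m by auto
    then show ?thesis using dead[OF y(2)] T by auto
  next
    case False
    then have "(R ^^ (n + (m - n))) x T" using m by simp
    then obtain y where y: "(R ^^ n) x y" "(R ^^ (m - n)) y T" using split by blast
    then have "y = S" using assms(1) by simp
    then show ?thesis using dead[OF y(2)] assms(2) by auto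
  qed
next
  assume "T = S"
  then show "R\<^sup>*\<^sup>* x T \<and> (\<nexists>U. R T U)"
    using assms(1,2) relpowp_imp_rtranclp by metis
qed

theorem theorem17p1:
  fixes C :: "'c set" and V :: "'b set" and pref :: "'b \<Rightarrow> 'c list"
    and s :: nat and es ord :: "'c list" and r :: "'b \<Rightarrow> real" and Ws :: "real list"
    and Q :: real
  assumes "ordered_election C V pref"
    and "s \<ge> 1"
    and "phragmen_run C V pref es r Ws" and "length es = s"
    and "Q = last Ws" and "Q > 0"
    and "distinct ord" and "set ord = C" and "take s ord = es"
  shows "(\<forall>es'. stv_result s Q ord C V pref es' \<longleftrightarrow> es' = es) \<and>
         (\<forall>k\<le>s. \<exists>S. (\<forall>T. (stv_step s Q ord C V pref ^^ k) stv_init T \<longleftrightarrow> T = S) \<and>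
            elected S = take k es \<and> eliminated S = {} \<and>
            (k < s \<longrightarrow> reaches_quota Q C V pref S (es ! k)))"
proof -
  let ?step = "stv_step s Q ord C V pref"
  let ?S = "phragmen_stv_state Q es r"
  have "finite V" using assms(1) by (simp add: ordered_election_def)
  then have "sorted_wrt (\<ge>) Ws" using phragmen_run_reduced_votes_decreasing[OF assms(3)] by simp
  \<comment> \<open>\<open>Ws\<close> is a fresh variable here, so that the induction is free of the
    facts about the given run.\<close>
  moreover have "last Ws \<le> W" if "sorted_wrt (\<ge>) Ws" "W \<in> set Ws" for W and Ws :: "real list"
    using that by (induction Ws rule: rev_induct) (auto simp: sorted_wrt_append)
  ultimately have "\<forall>W\<in>set Ws. Q \<le> W" using assms(5) by blast
  then have run: "\<And>T. (?step ^^ s) stv_init T \<longleftrightarrow> T = ?S"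
    "\<And>k. k < s \<Longrightarrow> \<exists>S. (\<forall>T. (?step ^^ k) stv_init T \<longleftrightarrow> T = S) \<and>
       elected S = take k es \<and> eliminated S = {} \<and> reaches_quota Q C V pref S (es ! k)"
    using stv_follows_phragmen_run[OF assms(3), of Q s ord] assms by simp_all
  have el: "elected ?S = es" "eliminated ?S = {}" by (simp_all add: phragmen_stv_state_def)
  \<comment> \<open>Both kinds of step require a free seat, and in \<open>?S\<close> all
    \<open>s\<close> seats are filled.\<close>
  then have "\<nexists>T. ?step ?S T" using assms(4) by (auto elim: stv_step.cases)
  then have terminal: "?step\<^sup>*\<^sup>* stv_init T \<and> (\<nexists>U. ?step T U) \<longleftrightarrow> T = ?S" for T
    using run by (intro rtranclp_terminal_iff_relpowp) blast+
  have "stv_result s Q ord C V pref es' \<longleftrightarrow> es' = es" for es'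
    unfolding stv_result_def using terminal el by metis
  moreover have "\<exists>S. (\<forall>T. (?step ^^ k) stv_init T \<longleftrightarrow> T = S) \<and>
      elected S = take k es \<and> eliminated S = {} \<and> (k < s \<longrightarrow> reaches_quota Q C V pref S (es ! k))"
    if "k \<le> s" for k
  proof (cases "k = s")
    case True
    then show ?thesis using run(1) el assms(4) by (intro exI[of _ ?S]) simp
  next
    case False
    then show ?thesis using run(2)[of k] that by auto
  qed
  ultimately show ?thesis by blast
qed

end
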